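(* Suppose there are a constant $c$ and a function $d(n,m)$ with $\lim_{m\to\infty} d(n,m)/m=0$ for every fixed $n$, such that for every $n$, every initial BST $T_0$ on $\{1,\dots,n\}$ and every query sequence $X\in[n]^m$, $$\mathrm{cost}(GF,X,T_0)\le c\cdot \mathrm{cost}(OPT,X,T_0)+d(n,m).$$ Then $c\ge 2$.
   Context: Binary search tree model. Keys are $\{1,\dots,n\}$. A query sequence is $X=[x_1,\dots,x_m]\in[n]^m$ and $T_0$ is an initial binary search tree (BST) on the keys. An algorithm $A$ serves $x_1,\dots,x_m$ in order. Before serving $x_t$ it holds a BST $T_{t-1}$; it searches $x_t$ from the root and may then restructure the tree by rotations into $T_t$. Let $P_t$ be the set of nodes on the root-to-$x_t$ path of $T_{t-1}$, and let $U_t$ be the node set of the minimal subtree containing all edges rotated in transforming $T_{t-1}$ into $T_t$. The cost at time $t$ is $|P_t\cup U_t|$. $\mathrm{cost}(A,X,T_0)$ is the sum of these costs over $t=1,\dots,m$, and $\hat c(A,X,T_0)=\mathrm{cost}(A,X,T_0)/m$. $OPT$ denotes an algorithm of minimum cost on $(X,T_0)$ that knows all of $X$ in advance. Greedy Future ($GF$). After finding $x_t$ in $T_{t-1}$, let $v_1<\dots<v_k$ be the keys on the root-to-$x_t$ path, set $v_0=-\infty$ and $v_{k+1}=+\infty$, and let $R_0,\dots,R_k$ be the subtrees hanging off this path. For each $i$, $\tau(v_i)$ is the smallest $s>t$ with $x_s\in(v_{i-1},v_{i+1})$, or $+\infty$ if there is none. $GF$ rearranges $v_1,\dots,v_k$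 as a treap: a BST in key order and a heap in $\tau$, with the smallest $\tau$ at the top. Ties in $\tau$ are broken in favor of the node of smaller depth in $T_{t-1}$. It then reattaches $R_0,\dots,R_k$ unchanged at their unique positions, giving $T_t$. *)

theory Defs
  imports Complex_Main "HOL-Library.Tree" "HOL-Library.Product_Lexorder"
begin

(* Keys are natural numbers; a BST on {1..n} is a t with  bst t  and  set_tree t = {1..n}. *)

fun rpath :: "nat tree \<Rightarrow> nat \<Rightarrow> nat list" where
  "rpath Leaf x = []"
| "rpath (Node l a r) x =
     a # (if x < a then rpath l x else if a < x then rpath r x else [])"

inductive rot :: "nat tree \<Rightarrow> nat \<times> nat \<Rightarrow> nat tree \<Rightarrow> bool" where
  rot_right: "rot (Node (Node a x b) y c) (x, y) (Node a x (Node b y c))"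
| rot_left:  "rot (Node a x (Node b y c)) (x, y) (Node (Node a x b) y c)"
| rot_l: "rot l e l' \<Longrightarrow> rot (Node l v r) e (Node l' v r)"
| rot_r: "rot r e r' \<Longrightarrow> rot (Node l v r) e (Node l v r')"

inductive rotseq :: "nat tree \<Rightarrow> (nat \<times> nat) list \<Rightarrow> nat tree \<Rightarrow> bool" where
  rotseq_nil: "rotseq t [] t"
| rotseq_cons: "rot t e t1 \<Longrightarrow> rotseq t1 es t2 \<Longrightarrow> rotseq t (e # es) t2"

(* S is the node set of a (connected) subtree of t: empty, or it has a top node s
   such that every node of S is a descendant of s and every node between s and
   a node of S also lies in S *)
definition subtree_set :: "nat tree \<Rightarrow> nat set \<Rightarrow> bool" where
  "subtree_set t S \<longleftrightarrow> S \<subseteq> set_tree t \<and>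
     (S = {} \<or> (\<exists>s\<in>S. \<forall>v\<in>S. s \<in> set (rpath t v) \<and>
        (\<forall>w\<in>set (rpath t v). s \<in> set (rpath t w) \<longrightarrow> w \<in> S)))"

(* cost of serving x in t and then transforming t into t' by rotations:
   |P \<union> U| minimised over rotation sequences realising the transformation
   (U = minimal subtree containing all rotated edges) *)
definition step_cost :: "nat tree \<Rightarrow> nat \<Rightarrow> nat tree \<Rightarrow> nat" where
  "step_cost t x t' = Inf {card (set (rpath t x) \<union> S) | rs S.
      rotseq t rs t' \<and> subtree_set t S \<and> (\<forall>(a, b)\<in>set rs. a \<in> S \<and> b \<in> S)}"

definition valid_run :: "nat list \<Rightarrow> nat tree \<Rightarrow> nat tree list \<Rightarrow> bool" where
  "valid_run X T0 Ts \<longleftrightarrow> length Ts = length X \<and>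
     (\<forall>t<length X. \<exists>rs. rotseq ((T0 # Ts) ! t) rs (Ts ! t))"

definition run_cost :: "nat list \<Rightarrow> nat tree \<Rightarrow> nat tree list \<Rightarrow> nat" where
  "run_cost X T0 Ts = (\<Sum>t<length X. step_cost ((T0 # Ts) ! t) (X ! t) (Ts ! t))"

definition opt_cost :: "nat list \<Rightarrow> nat tree \<Rightarrow> nat" where
  "opt_cost X T0 = Inf {run_cost X T0 Ts | Ts. valid_run X T0 Ts}"

fun hang :: "nat tree \<Rightarrow> nat \<Rightarrow> nat tree list" where
  "hang Leaf x = [Leaf]"
| "hang (Node l a r) x =
     (if x < a then hang l x @ [r] else if a < x then l # hang r x else [l, r])"

(* tau(v) at (0-based) time t, with path key set PK; "infinity" is encoded as length X *)
definition gf_tau :: "nat list \<Rightarrow> nat \<Rightarrow> nat set \<Rightarrow> nat \<Rightarrow> nat" where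
  "gf_tau X t PK v =
     (let G = (\<lambda>y. (\<forall>w\<in>PK. w < v \<longrightarrow> w < y) \<and> (\<forall>w\<in>PK. v < w \<longrightarrow> y < w));
          F = {s. t < s \<and> s < length X \<and> G (X ! s)}
      in if F = {} then length X else Min F)"

(* priority of a path key: (tau, depth); smaller is higher in the treap *)
definition gf_prio :: "nat list \<Rightarrow> nat \<Rightarrow> nat tree \<Rightarrow> nat \<Rightarrow> nat \<times> nat" where
  "gf_prio X t T v =
     (gf_tau X t (set (rpath T (X ! t))) v, length (takeWhile (\<lambda>u. u \<noteq> v) (rpath T (X ! t))))"

fun minby :: "('a \<Rightarrow> 'b::linorder) \<Rightarrow> 'a \<Rightarrow> 'a list \<Rightarrow> 'a" where
  "minby f a [] = a"
| "minby f a (b # bs) = minby f (if f b < f a then b else a) bs"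

lemma minby_in: "minby f a bs \<in> set (a # bs)"
  by (induction bs arbitrary: a) (simp, fastforce)

(* treap on the sorted keys vs with the hanging subtrees Rs (length vs + 1) reattached *)
function treap_build :: "(nat \<Rightarrow> nat \<times> nat) \<Rightarrow> nat list \<Rightarrow> nat tree list \<Rightarrow> nat tree" where
  "treap_build p [] Rs = (case Rs of [] \<Rightarrow> Leaf | R # _ \<Rightarrow> R)"
| "treap_build p (u # us) Rs =
     (let vs = u # us; v = minby p u us;
          L = filter (\<lambda>w. w < v) vs; R = filter (\<lambda>w. v < w) vs
      in Node (treap_build p L (take (length L + 1) Rs)) v
              (treap_build p R (drop (length L + 1) Rs)))"
  by pat_completeness auto
termination
proof (relation "measure (\<lambda>(p, vs, Rs). length vs)", goal_cases)
  case 1 then show ?case by simp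
next
  case (2 p u us Rs vs v L R)
  have "v \<in> set vs" using 2 minby_in by simp
  then have "length (filter (\<lambda>w. w < v) vs) < length vs"
    by (metis length_filter_less less_irrefl)
  then show ?case using 2 by simp
next
  case (3 p u us Rs vs v L R)
  have "v \<in> set vs" using 3 minby_in by simp
  then have "length (filter (\<lambda>w. v < w) vs) < length vs"
    by (metis length_filter_less less_irrefl)
  then show ?case using 3 by simp
qed

definition gf_step :: "nat list \<Rightarrow> nat \<Rightarrow> nat tree \<Rightarrow> nat tree" where
  "gf_step X t T =
     treap_build (gf_prio X t T) (sort (rpath T (X ! t))) (hang T (X ! t))"

function gf_run :: "nat list \<Rightarrow> nat \<Rightarrow> nat tree \<Rightarrow> nat tree list" where
  "gf_run X t T = (if t < length X then (let T' = gf_step X t T in T' # gf_run X (Suc t) T') else [])"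
  by pat_completeness auto
termination by (relation "measure (\<lambda>(X, t, T). length X - t)") auto

definition gf_cost :: "nat list \<Rightarrow> nat tree \<Rightarrow> nat" where
  "gf_cost X T0 = run_cost X T0 (gf_run X 0 T0)"

end

theory Submission
  imports Defs
begin

text \<open>The level \<open>D + 1\<close> query sequence cycles through three blocks \<open>A < B < C\<close> of keys, where \<open>A\<close> and
  \<open>C\<close> are copies of level \<open>D\<close>, each served by its own level \<open>D\<close> sequence, and \<open>B\<close> is a single
  key. Two further keys, \<open>c\<close> between \<open>A\<close> and \<open>B\<close> and \<open>v\<close> between \<open>B\<close> and \<open>C\<close>, are never queried.
  In the tree with root \<open>v\<close>, left child \<open>c\<close> and the blocks below, the cyclic order makes the root
  always a key of smallest \<open>\<tau>\<close>, and \<open>c\<close> next to it, so Greedy Future never changes the tree. Its average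
  cost satisfies \<open>g' = 2 + 2g/3\<close>, with limit 6. The static tree that has the key of \<open>B\<close> at the root
  and hides \<open>c\<close> and \<open>v\<close> at the bottom has average cost \<open>h' = 1 + 2h/3\<close>, with limit 3.\<close>

section \<open>The query sequence and the two trees\<close>

fun num_keys :: "nat \<Rightarrow> nat" where
  "num_keys 0 = 1"
| "num_keys (Suc D) = 2 * num_keys D + 3"

text \<open>Defined for all times, so that a copy can run at a third of the speed by reading
  \<open>t div 3\<close>; the actual inputs are prefixes. The offset \<open>k\<close> shifts the
  block of keys.\<close>

fun query :: "nat \<Rightarrow> nat \<Rightarrow> nat \<Rightarrow> nat" where
  "query 0 k t = k + 1"
| "query (Suc D) k t =
     (if t mod 3 = 0 then query D k (t div 3)
      else if t mod 3 = 1 then k + num_keys D + 2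
      else query D (k + num_keys D + 3) (t div 3))"

fun gf_tree :: "nat \<Rightarrow> nat \<Rightarrow> nat tree" where
  "gf_tree 0 k = Node Leaf (k + 1) Leaf"
| "gf_tree (Suc D) k =
     Node (Node (gf_tree D k) (k + num_keys D + 1) (Node Leaf (k + num_keys D + 2) Leaf))
       (k + num_keys D + 3) (gf_tree D (k + num_keys D + 3))"

text \<open>The arguments \<open>L\<close> and \<open>R\<close> replace the leftmost and the rightmost leaf; the keys that are
  never queried are put there, out of the way of all searches.\<close>

fun good_tree :: "nat \<Rightarrow> nat \<Rightarrow> nat tree \<Rightarrow> nat tree \<Rightarrow> nat tree" where
  "good_tree 0 k L R = Node L (k + 1) R"
| "good_tree (Suc D) k L R =
     Node (good_tree D k L (Node Leaf (k + num_keys D + 1) Leaf)) (k + num_keys D + 2)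
       (good_tree D (k + num_keys D + 3) (Node Leaf (k + num_keys D + 3) Leaf) R)"

lemma query_bounds: "k < query D k t \<and> query D k t \<le> k + num_keys D"
proof (induction D arbitrary: k t)
  case (Suc D)
  show ?case using Suc[of k "t div 3"] Suc[of "k + num_keys D + 3" "t div 3"] by auto
qed simp

lemmas query_gt = query_bounds[THEN conjunct1]
lemmas query_le = query_bounds[THEN conjunct2]

lemma set_gf_tree: "set_tree (gf_tree D k) = {k + 1..k + num_keys D}"
proof (induction D arbitrary: k)
  case (Suc D)
  show ?case by (simp only: gf_tree.simps tree.set Suc) auto
qed auto

lemma bst_gf_tree: "bst (gf_tree D k)"
  by (induction D arbitrary: k) (auto simp: set_gf_tree)

lemma set_good_tree:
  "set_tree (good_tree D k L R) = set_tree L \<union> {k + 1..k + num_keys D} \<union> set_tree R"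
proof (induction D arbitrary: k L R)
  case (Suc D)
  show ?case by (simp only: good_tree.simps tree.set Suc) auto
qed auto

text \<open>The bound on \<open>L\<close> is weak because a block with offset \<open>k\<close>
  starts at \<open>k + 1\<close>: the key hung into the right copy equals the offset of that
  copy.\<close>

lemma bst_good_tree:
  assumes "bst L" "bst R" "\<forall>x\<in>set_tree L. x \<le> k" "\<forall>x\<in>set_tree R. k + num_keys D < x"
  shows "bst (good_tree D k L R)"
  using assms
proof (induction D arbitrary: k L R)
  case 0
  then show ?case by fastforce
next
  case (Suc D)
  have "bst (good_tree D k L (Node Leaf (k + num_keys D + 1) Leaf))"
    using Suc.prems by (intro Suc.IH) auto
  moreover have "bst (good_tree D (k + num_keys D + 3) (Node Leaf (k + num_keys D + 3) Leaf) R)"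
    using Suc.prems by (intro Suc.IH) auto
  ultimately show ?case
    using Suc.prems by (fastforce simp: set_good_tree)
qed

section \<open>Costs of static trees\<close>

lemma set_rpath: "set (rpath T x) \<subseteq> set_tree T"
  by (induction T x rule: rpath.induct) auto

lemma distinct_rpath: "bst T \<Longrightarrow> distinct (rpath T x)"
proof (induction T x rule: rpath.induct)
  case (2 l a r x)
  then show ?case using set_rpath[of l x] set_rpath[of r x] by auto
qed simp

lemma step_cost_le:
  assumes "rotseq T rs T'" "subtree_set T S" "\<forall>(a, b)\<in>set rs. a \<in> S \<and> b \<in> S"
  shows "step_cost T x T' \<le> card (set (rpath T x) \<union> S)"
  unfolding step_cost_def by (rule cInf_lower) (use assms in auto)

lemma subtree_set_empty: "subtree_set T {}"
  by (simp add: subtree_set_def)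

lemma step_cost_static_le: "step_cost T x T \<le> length (rpath T x)"
proof -
  have "step_cost T x T \<le> card (set (rpath T x))"
    using step_cost_le[OF rotseq_nil subtree_set_empty, of T x] by simp
  then show ?thesis using card_length le_trans by blast
qed

text \<open>Every admissible node set is united with the search path, so no choice of
  \<open>S\<close> undercuts the path. The lower bound is what makes the cost of Greedy Future
  exact.\<close>

lemma step_cost_static:
  assumes "bst T" shows "step_cost T x T = length (rpath T x)"
proof (rule antisym[OF step_cost_static_le])
  have "card (set (rpath T x)) \<le> step_cost T x T"
    unfolding step_cost_def
  proof (rule cInf_greatest)
    show "{card (set (rpath T x) \<union> S) |rs S. rotseq T rs T \<and> subtree_set T S \<and>
        (\<forall>(a, b)\<in>set rs. a \<in> S \<and> b \<in> S)} \<noteq> {}"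
      using rotseq_nil[of T] subtree_set_empty[of T] by fastforce
  next
    fix c
    assume "c \<in> {card (set (rpath T x) \<union> S) |rs S. rotseq T rs T \<and> subtree_set T S \<and>
        (\<forall>(a, b)\<in>set rs. a \<in> S \<and> b \<in> S)}"
    then obtain S where "c = card (set (rpath T x) \<union> S)" "subtree_set T S" by blast
    \<comment> \<open>Finiteness matters because \<open>card\<close> of an infinite set is
      0.\<close>
    moreover from this have "finite S"
      unfolding subtree_set_def using finite_set_tree finite_subset by blast
    ultimately show "card (set (rpath T x)) \<le> c" by (auto intro: card_mono)
  qed
  then show "length (rpath T x) \<le> step_cost T x T"
    using distinct_card[OF distinct_rpath[OF assms]] by simp
qed

section \<open>Rotations connect all search trees on the same keys\<close>

lemma rotseq_append: "rotseq T rs U \<Longrightarrow> rotseq U ss V \<Longrightarrow> rotseq T (rs @ ss) V"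
  by (induction rule: rotseq.induct) (auto intro: rotseq.intros)

lemma rotseq_left: "rotseq l rs l' \<Longrightarrow> rotseq (Node l a r) rs (Node l' a r)"
  by (induction rule: rotseq.induct) (auto intro: rot.intros rotseq.intros)

lemma rotseq_right: "rotseq r rs r' \<Longrightarrow> rotseq (Node l a r) rs (Node l a r')"
  by (induction rule: rotseq.induct) (auto intro: rot.intros rotseq.intros)

lemma rot_sym: "rot T e U \<Longrightarrow> rot U e T"
  by (induction rule: rot.induct) (auto intro: rot.intros)

lemma rotseq_rev: "rotseq T rs U \<Longrightarrow> rotseq U (rev rs) T"
proof (induction rule: rotseq.induct)
  case (rotseq_cons T e T1 es T2)
  have "rotseq T1 [e] T" using rotseq_cons(1) by (auto intro: rot_sym rotseq.intros)
  then show ?case using rotseq_append[OF rotseq_cons.IH] by simp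
qed (auto intro: rotseq.intros)

lemma rot_keys: "rot T e U \<Longrightarrow> set_tree U = set_tree T \<and> fst e \<in> set_tree T \<and> snd e \<in> set_tree T"
  by (induction rule: rot.induct) auto

lemma rotseq_keys: "rotseq T rs U \<Longrightarrow> \<forall>(a, b)\<in>set rs. a \<in> set_tree T \<and> b \<in> set_tree T"
  by (induction rule: rotseq.induct) (auto dest!: rot_keys)

fun right_spine :: "nat list \<Rightarrow> nat tree" where
  "right_spine [] = Leaf"
| "right_spine (x # xs) = Node Leaf x (right_spine xs)"

text \<open>One right rotation lifts the head of the left spine to the root; the rest of the merge
  takes place in its right subtree.\<close>

lemma rotseq_merge_spines:
  "\<exists>rs. rotseq (Node (right_spine xs) a (right_spine ys)) rs (right_spine (xs @ a # ys))"
proof (induction xs)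
  case Nil
  then show ?case by (auto intro: rotseq.intros)
next
  case (Cons x xs)
  then obtain rs where "rotseq (Node (right_spine xs) a (right_spine ys)) rs (right_spine (xs @ a # ys))"
    by blast
  then have "rotseq (Node (right_spine (x # xs)) a (right_spine ys)) ((x, a) # rs)
      (right_spine ((x # xs) @ a # ys))"
    using rotseq_cons[OF rot_right rotseq_right] by simp
  then show ?case by blast
qed

lemma rotseq_right_spine: "\<exists>rs. rotseq T rs (right_spine (inorder T))"
proof (induction T)
  case Leaf
  then show ?case by (auto intro: rotseq.intros)
next
  case (Node l a r)
  then obtain rs ss where "rotseq l rs (right_spine (inorder l))" "rotseq r ss (right_spine (inorder r))"
    by blast
  then have "rotseq (Node l a r) (rs @ ss) (Node (right_spine (inorder l)) a (right_spine (inorder r)))"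
    by (blast intro: rotseq_append rotseq_left rotseq_right)
  then show ?case
    using rotseq_merge_spines[of "inorder l" a "inorder r"] by (auto intro: rotseq_append)
qed

text \<open>The right spine is a normal form determined by the inorder list: rotate \<open>T\<close>
  into it, then undo the rotations that lead there from \<open>U\<close>.\<close>

lemma rotseq_exists:
  assumes "bst T" "bst U" "set_tree T = set_tree U"
  shows "\<exists>rs. rotseq T rs U"
proof -
  have eq: "inorder T = inorder U"
    using assms by (intro strict_sorted_equal) (simp_all add: bst_iff_sorted_wrt_less)
  obtain rs ss where "rotseq T rs (right_spine (inorder U))" "rotseq U ss (right_spine (inorder U))"
    using rotseq_right_spine[of T] rotseq_right_spine[of U] eq by auto
  then show ?thesis by (blast intro: rotseq_append rotseq_rev)
qed

lemma subtree_set_all: "subtree_set T (set_tree T)"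
proof (cases T)
  case (Node l a r)
  then have "\<forall>v\<in>set_tree T. a \<in> set (rpath T v)" by simp
  then show ?thesis
    unfolding subtree_set_def using Node set_rpath[of T] by blast
qed (simp add: subtree_set_def)

lemma step_cost_le_card:
  assumes "bst T" "bst U" "set_tree T = set_tree U"
  shows "step_cost T x U \<le> card (set_tree T)"
proof -
  obtain rs where "rotseq T rs U" using rotseq_exists[OF assms] by blast
  from step_cost_le[OF this subtree_set_all rotseq_keys[OF this], of x] show ?thesis
    using set_rpath[of T x] by (simp only: Un_absorb1)
qed

text \<open>The competitor rebuilds \<open>T\<close> into \<open>U\<close> during the first step and
  then stays put. The rebuilding costs at most the number of keys, independently of the number of
  queries.\<close>

lemma opt_cost_le_static:
  assumes "bst T" "bst U" "set_tree T = set_tree U"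
  shows "opt_cost X T \<le> card (set_tree T) + (\<Sum>t<length X. length (rpath U (X ! t)))"
proof -
  let ?Us = "replicate (length X) U"
  have *: "(T # ?Us) ! t = (if t = 0 then T else U)" if "t < length X" for t
    using that by (cases t) auto
  have "valid_run X T ?Us"
    unfolding valid_run_def
  proof (intro conjI allI impI)
    fix t assume "t < length X"
    then show "\<exists>rs. rotseq ((T # ?Us) ! t) rs (?Us ! t)"
      using rotseq_exists[OF assms] rotseq_nil[of U] by (cases "t = 0") (auto simp: *)
  qed simp
  then have "opt_cost X T \<le> run_cost X T ?Us"
    unfolding opt_cost_def by (intro cInf_lower) auto
  also have "\<dots> \<le> (\<Sum>t<length X. (if t = 0 then card (set_tree T) else 0) + length (rpath U (X ! t)))"
    unfolding run_cost_def
    using * step_cost_le_card[OF assms] step_cost_static_le by (intro sum_mono) (auto intro: trans_le_add1)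
  also have "\<dots> \<le> card (set_tree T) + (\<Sum>t<length X. length (rpath U (X ! t)))"
    by (simp add: sum.distrib sum.delta)
  finally show ?thesis .
qed

section \<open>When Greedy Future leaves the tree unchanged\<close>

lemma minby_eqI:
  assumes "v \<in> set (u # us)" "\<forall>w\<in>set (u # us) - {v}. p v < p w"
  shows "minby p u us = v"
  using assms
proof (induction us arbitrary: u)
  case (Cons w us)
  show ?case
    unfolding minby.simps by (rule Cons.IH) (use Cons.prems in \<open>auto split: if_splits dest: less_asym\<close>)
qed auto

text \<open>Makes the \<open>take\<close>/\<open>drop\<close> split in \<open>treap_build\<close>
  fall exactly between the subtrees hanging left and right of the chosen root.\<close>

lemma length_hang: "length (hang T x) = length (rpath T x) + 1"
  by (induction T x rule: hang.induct) auto

lemma treap_build_eqI: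
  assumes "vs \<noteq> []" "v \<in> set vs" "\<forall>w\<in>set vs - {v}. p v < p w"
  shows "treap_build p vs Rs =
    Node (treap_build p (filter (\<lambda>w. w < v) vs) (take (length (filter (\<lambda>w. w < v) vs) + 1) Rs)) v
      (treap_build p (filter (\<lambda>w. v < w) vs) (drop (length (filter (\<lambda>w. w < v) vs) + 1) Rs))"
proof -
  obtain u us where vs: "vs = u # us" using assms(1) by (cases vs) auto
  have "minby p u us = v" using assms vs by (intro minby_eqI) auto
  then show ?thesis unfolding vs by (simp only: treap_build.simps Let_def)
qed

text \<open>If priorities increase down the path, the old root is chosen again. All other path keys
  lie on one side of it, so the other side gets back its hanging subtree and the recursion follows
  the path.\<close>

lemma treap_build_path:
  assumes "bst T" "sorted_wrt (\<lambda>a b. p a < p b) (rpath T x)"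
  shows "treap_build p (sort (rpath T x)) (hang T x) = T"
  using assms
proof (induction T x rule: rpath.induct)
  case (2 l a r x)
  note tb = treap_build_eqI[of "sort (rpath (Node l a r) x)" a p "hang (Node l a r) x"]
  have min: "\<forall>w\<in>set (sort (rpath (Node l a r) x)) - {a}. p a < p w"
    unfolding set_sort using "2.prems"(2) by (auto split: if_splits)
  have ne: "sort (rpath (Node l a r) x) \<noteq> []" "a \<in> set (sort (rpath (Node l a r) x))"
    unfolding set_sort set_empty[symmetric] by simp_all
  have less: "\<forall>w\<in>set (rpath l x). w < a" and greater: "\<forall>w\<in>set (rpath r x). a < w"
    using set_rpath[of l x] set_rpath[of r x] "2.prems"(1) by auto
  consider (lt) "x < a" | (gt) "a < x" | (eq) "x = a" by linarith
  then show ?case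
  proof cases
    case lt
    have "filter (\<lambda>w. w < a) (rpath l x) = rpath l x" "filter (\<lambda>w. a < w) (rpath l x) = []"
      using less by (auto simp: filter_id_conv filter_empty_conv)
    then have fl: "filter (\<lambda>w. w < a) (sort (a # rpath l x)) = sort (rpath l x)"
      "filter (\<lambda>w. a < w) (sort (a # rpath l x)) = []"
      unfolding filter_sort by simp_all
    show ?thesis
      using tb[OF ne min] 2 lt by (simp add: fl length_hang del: sort_key_simps)
  next
    case gt
    have "filter (\<lambda>w. w < a) (rpath r x) = []" "filter (\<lambda>w. a < w) (rpath r x) = rpath r x"
      using greater by (auto simp: filter_id_conv filter_empty_conv)
    then have fl: "filter (\<lambda>w. w < a) (sort (a # rpath r x)) = []"
      "filter (\<lambda>w. a < w) (sort (a # rpath r x)) = sort (rpath r x)"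
      unfolding filter_sort by simp_all
    show ?thesis
      using tb[OF ne min] 2 gt by (simp add: fl length_hang del: sort_key_simps)
  next
    case eq
    then show ?thesis using tb[OF ne min] by simp
  qed
qed simp

text \<open>The open interval between the neighbours of \<open>v\<close> in \<open>P\<close>; the
  first later query inside it defines \<open>\<tau>\<close>.\<close>

definition gap :: "nat set \<Rightarrow> nat \<Rightarrow> nat set" where
  "gap P v = {y. (\<forall>w\<in>P. w < v \<longrightarrow> w < y) \<and> (\<forall>w\<in>P. v < w \<longrightarrow> y < w)}"

text \<open>Encodes that \<open>\<tau>\<close> of \<open>a\<close> is at most that of
  \<open>b\<close> along an infinite sequence. Phrased by witnesses instead of minima, it passes to
  every finite prefix.\<close>

definition gap_before :: "(nat \<Rightarrow> nat) \<Rightarrow> nat \<Rightarrow> nat set \<Rightarrow> nat \<Rightarrow> nat \<Rightarrow> bool" where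
  "gap_before f t P a b \<longleftrightarrow>
     (\<forall>s>t. f s \<in> gap P b \<longrightarrow> (\<exists>s'>t. s' \<le> s \<and> f s' \<in> gap P a))"

text \<open>The witness for \<open>a\<close> comes no later than the query for \<open>b\<close>, so
  it lies in the same prefix. If the gap of \<open>b\<close> is never hit, its value
  \<open>length X\<close> is an upper bound anyway.\<close>

lemma gf_tau_mono:
  assumes "gap_before f t P a b" "\<And>s. s < length X \<Longrightarrow> X ! s = f s"
  shows "gf_tau X t P a \<le> gf_tau X t P b"
proof -
  let ?F = "\<lambda>v. {s. t < s \<and> s < length X \<and> X ! s \<in> gap P v}"
  have tau: "gf_tau X t P v = (if ?F v = {} then length X else Min (?F v))" for v
    unfolding gf_tau_def gap_def Let_def mem_Collect_eq ..
  have fin: "finite (?F v)" for v by simp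
  have le: "Min (?F v) \<le> length X" if "?F v \<noteq> {}" for v
    using Min_in[OF fin that] by simp
  show ?thesis
  proof (cases "?F b = {}")
    case True
    then show ?thesis using le[of a] by (auto simp: tau)
  next
    case False
    define s where "s = Min (?F b)"
    have s: "t < s" "s < length X" "X ! s \<in> gap P b"
      using Min_in[OF fin False] unfolding s_def by auto
    then obtain s' where s': "t < s'" "s' \<le> s" "f s' \<in> gap P a"
      using assms unfolding gap_before_def by auto
    then have "s' \<in> ?F a" using assms(2) s(2) by simp
    then have "gf_tau X t P a \<le> s'" using Min_le[OF fin, of s' a] by (auto simp: tau)
    also have "s' \<le> gf_tau X t P b" using s'(2) False by (simp only: tau s_def if_False)
    finally show ?thesis .
  qed
qed

lemma sorted_wrt_takeWhile:
  "distinct xs \<Longrightarrow>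
    sorted_wrt (\<lambda>a b. length (takeWhile (\<lambda>u. u \<noteq> a) xs) < length (takeWhile (\<lambda>u. u \<noteq> b) xs)) xs"
proof (induction xs)
  case (Cons x xs)
  have "sorted_wrt (\<lambda>a b. length (takeWhile (\<lambda>u. u \<noteq> a) (x # xs))
      < length (takeWhile (\<lambda>u. u \<noteq> b) (x # xs))) xs"
    using Cons by (intro sorted_wrt_mono_rel[OF _ Cons.IH]) auto
  then show ?case using Cons.prems by auto
qed simp

text \<open>Weak order suffices for \<open>\<tau>\<close>, since depth increases strictly along the
  path and breaks ties: the lexicographic priority is strictly increasing.\<close>

lemma gf_step_static:
  assumes "bst T" "\<And>s. s < length X \<Longrightarrow> X ! s = f s"
    and "sorted_wrt (gap_before f t (set (rpath T (X ! t)))) (rpath T (X ! t))"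
  shows "gf_step X t T = T"
  unfolding gf_step_def
proof (rule treap_build_path[OF assms(1)])
  let ?P = "rpath T (X ! t)"
  have "sorted_wrt (\<lambda>a b. gap_before f t (set ?P) a b \<and>
      length (takeWhile (\<lambda>u. u \<noteq> a) ?P) < length (takeWhile (\<lambda>u. u \<noteq> b) ?P)) ?P"
    using assms(3) sorted_wrt_takeWhile[OF distinct_rpath[OF assms(1), of "X ! t"]]
    by (simp add: sorted_wrt_iff_nth_less)
  then show "sorted_wrt (\<lambda>a b. gf_prio X t T a < gf_prio X t T b) ?P"
    by (rule sorted_wrt_mono_rel[rotated]) (auto simp: gf_prio_def less_prod_def gf_tau_mono[OF _ assms(2)])
qed

declare gf_run.simps [simp del]

lemma gf_run_static:
  assumes "\<And>t. t < length X \<Longrightarrow> gf_step X t T = T"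
  shows "gf_run X t T = replicate (length X - t) T"
proof (induction "length X - t" arbitrary: t)
  case (Suc i)
  then have "gf_run X (Suc t) T = replicate (length X - Suc t) T" by simp
  then show ?case using assms[of t] Suc.hyps(2)
    by (subst gf_run.simps) (simp add: Let_def Suc_diff_Suc flip: replicate_Suc)
qed (simp add: gf_run.simps)

lemma gf_cost_static:
  assumes "bst T" "\<And>t. t < length X \<Longrightarrow> gf_step X t T = T"
  shows "gf_cost X T = (\<Sum>t<length X. length (rpath T (X ! t)))"
proof -
  have "(T # replicate (length X) T) ! t = T" if "t < length X" for t
    using that by (cases t) auto
  moreover have "gf_run X 0 T = replicate (length X) T"
    using gf_run_static[of X T 0] assms(2) by simp
  ultimately show ?thesis
    unfolding gf_cost_def run_cost_def by (simp add: step_cost_static[OF assms(1)])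
qed

section \<open>Greedy Future on the recursive sequence\<close>

text \<open>No query can come earlier than time \<open>t + 1\<close>, so such a key precedes every
  other.\<close>

lemma gap_before_next: "f (Suc t) \<in> gap P a \<Longrightarrow> gap_before f t P a b"
  unfolding gap_before_def using Suc_leI by blast

text \<open>Inside the left or the right copy, a key can only be overtaken through queries to that copy,
  so the order established for the copy carries over with time slowed down by the factor 3.\<close>

lemma gap_before_subsequence:
  assumes "gap_before g q P a b" "a \<in> A" "b \<in> A" "i < 3"
    and sub: "\<And>s v. v \<in> A \<Longrightarrow> f s \<in> gap P' v \<longleftrightarrow> s mod 3 = i \<and> g (s div 3) \<in> gap P v"
  shows "gap_before f (3 * q + i) P' a b"
  unfolding gap_before_def
proof (intro allI impI)
  fix s assume s: "3 * q + i < s" "f s \<in> gap P' b"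
  then have m: "s mod 3 = i" "g (s div 3) \<in> gap P b" using sub[OF assms(3)] by auto
  then have "q < s div 3" using s(1) by presburger
  then obtain r where r: "q < r" "r \<le> s div 3" "g r \<in> gap P a"
    using assms(1) m unfolding gap_before_def by blast
  \<comment> \<open>Time \<open>3 * r + i\<close> is when the copy receives its query number
    \<open>r\<close>.\<close>
  have "f (3 * r + i) \<in> gap P' a" using sub[OF assms(2)] r(3) assms(4) by simp
  moreover have "3 * r + i \<le> s" using r(2) m(1) by presburger
  ultimately show "\<exists>s'>3 * q + i. s' \<le> s \<and> f s' \<in> gap P' a"
    using r(1) by (intro exI[of _ "3 * r + i"]) auto
qed

text \<open>Induction on the level, by the block queried at time \<open>t\<close>. The next query
  always falls into the gap of the root, \<open>c\<close> comes next if it is on the path, and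
  inside a copy the order is inherited.\<close>

lemma sorted_path_gf_tree:
  "sorted_wrt (gap_before (query D k) t (set (rpath (gf_tree D k) (query D k t))))
     (rpath (gf_tree D k) (query D k t))"
proof (induction D arbitrary: k t)
  case (Suc D)
  let ?N = "num_keys D" and ?q = "t div 3" and ?f = "query (Suc D) k"
  let ?c = "k + ?N + 1" and ?b = "k + ?N + 2" and ?v = "k + ?N + 3"
  define P where "P = rpath (gf_tree (Suc D) k) (?f t)"
  note gA = query_gt[of k D] and lA = query_le[of D k]
    and gC = query_gt[of ?v D] and lC = query_le[of D ?v]
  have "t mod 3 = 0 \<or> t mod 3 = 1 \<or> t mod 3 = 2" by presburger
  then have "sorted_wrt (gap_before ?f t (set P)) P"
  proof (elim disjE, goal_cases)
    case 1
    define A where "A = rpath (gf_tree D k) (query D k ?q)"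
    have A: "\<forall>w\<in>set A. k < w \<and> w < ?c"
      using set_rpath[of "gf_tree D k"] unfolding A_def set_gf_tree by fastforce
    have P: "P = ?v # ?c # A"
      using 1 lA[of ?q] by (simp add: P_def A_def)
    \<comment> \<open>The next query lies between \<open>?c\<close> and \<open>?v\<close>, hence in
      both gaps: a tie that depth resolves.\<close>
    have "Suc t mod 3 = 1" using 1 by presburger
    then have "?f (Suc t) = ?b" by simp
    then have "?f (Suc t) \<in> gap (set P) ?v" "?f (Suc t) \<in> gap (set P) ?c"
      using A unfolding P gap_def by (auto simp del: query.simps)
    moreover have "sorted_wrt (gap_before ?f t (set P)) A"
    proof (rule sorted_wrt_mono_rel[OF _ Suc.IH[of k ?q, folded A_def]])
      fix a b assume ab: "a \<in> set A" "b \<in> set A" "gap_before (query D k) ?q (set A) a b"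
      \<comment> \<open>The path key \<open>?c\<close> caps the gaps of keys in \<open>A\<close>,
        shutting out all queries to the other blocks.\<close>
      have "?f s \<in> gap (set P) v \<longleftrightarrow> s mod 3 = 0 \<and> query D k (s div 3) \<in> gap (set A) v"
        if "v \<in> set A" for s v
      proof (cases "s mod 3 = 0")
        case True
        then have "?f s < ?c" using lA[of "s div 3"] by simp
        moreover have "v < ?c" using that A by blast
        ultimately show ?thesis using True unfolding P gap_def by auto
      next
        case False
        then have "?c < ?f s" using gC[of "s div 3"] by simp
        moreover have "v < ?c" using that A by blast
        ultimately show ?thesis using False unfolding P gap_def by (auto simp del: query.simps)
      qed
      from gap_before_subsequence[OF ab(3,1,2) _ this]
      have "gap_before ?f (3 * ?q + 0) (set P) a b" by (simp del: query.simps)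
      moreover have "3 * ?q + 0 = t" using 1 by presburger
      ultimately show "gap_before ?f t (set P) a b" by (simp only:)
    qed
    ultimately show ?thesis unfolding P by (auto intro: gap_before_next)
  next
    case 2
    have P: "P = [?v, ?c, ?b]" using 2 by (simp add: P_def)
    have m: "Suc t mod 3 = 2" "Suc (Suc t) mod 3 = 0" using 2 by presburger+
    have fC: "?v < ?f (Suc t)" and fA: "?f (Suc (Suc t)) < ?c"
      using m gC[of "Suc t div 3"] lA[of "Suc (Suc t) div 3"] by simp_all
    have "?f (Suc t) \<in> gap (set P) ?v"
      using fC unfolding P gap_def by (simp del: query.simps)
    \<comment> \<open>The query to \<open>C\<close> at \<open>t + 1\<close> misses the gap of
      \<open>?b\<close>, and the one to \<open>A\<close> at \<open>t + 2\<close> hits the gap of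
      \<open>?c\<close>.\<close>
    moreover have "gap_before ?f t (set P) ?c ?b"
      unfolding gap_before_def
    proof (intro allI impI)
      fix s assume s: "t < s" "?f s \<in> gap (set P) ?b"
      then have "?f s < ?v" unfolding P gap_def by (simp del: query.simps)
      with fC have "s \<noteq> Suc t" by (auto simp del: query.simps)
      moreover have "?f (Suc (Suc t)) \<in> gap (set P) ?c"
        using fA unfolding P gap_def by (simp del: query.simps)
      ultimately show "\<exists>s'>t. s' \<le> s \<and> ?f s' \<in> gap (set P) ?c"
        using s(1) by (intro exI[of _ "Suc (Suc t)"]) (auto simp del: query.simps)
    qed
    ultimately show ?thesis unfolding P by (auto intro: gap_before_next)
  next
    case 3
    define C where "C = rpath (gf_tree D ?v) (query D ?v ?q)"
    have C: "\<forall>w\<in>set C. ?v < w"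
      using set_rpath[of "gf_tree D ?v"] unfolding C_def set_gf_tree by fastforce
    have P: "P = ?v # C"
      using 3 gC[of ?q] by (simp add: P_def C_def)
    \<comment> \<open>Here \<open>c\<close> is not on the path, so the gap of \<open>?v\<close> is
      unbounded below and contains the coming query to \<open>A\<close>.\<close>
    have "Suc t mod 3 = 0" using 3 by presburger
    then have "?f (Suc t) < ?v" using lA[of "Suc t div 3"] by simp
    then have "?f (Suc t) \<in> gap (set P) ?v"
      using C unfolding P gap_def by (auto simp del: query.simps)
    moreover have "sorted_wrt (gap_before ?f t (set P)) C"
    proof (rule sorted_wrt_mono_rel[OF _ Suc.IH[of ?v ?q, folded C_def]])
      fix a b assume ab: "a \<in> set C" "b \<in> set C" "gap_before (query D ?v) ?q (set C) a b"
      have "?f s \<in> gap (set P) v \<longleftrightarrow> s mod 3 = 2 \<and> query D ?v (s div 3) \<in> gap (set C) v"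
        if "v \<in> set C" for s v
      proof (cases "s mod 3 = 2")
        case True
        then have f: "?f s = query D ?v (s div 3)" by simp
        moreover have "?v < ?f s" using f gC[of "s div 3"] by simp
        moreover have "?v < v" using that C by blast
        ultimately show ?thesis using True unfolding P gap_def by auto
      next
        case False
        then have "s mod 3 = 0 \<or> s mod 3 = 1" by presburger
        then have "?f s < ?v" using lA[of "s div 3"] by auto
        moreover have "?v < v" using that C by blast
        ultimately show ?thesis using False unfolding P gap_def by (auto simp del: query.simps)
      qed
      from gap_before_subsequence[OF ab(3,1,2) _ this]
      have "gap_before ?f (3 * ?q + 2) (set P) a b" by (simp del: query.simps)
      moreover have "3 * ?q + 2 = t" using 3 by presburger
      ultimately show "gap_before ?f t (set P) a b" by (simp only:)
    qed
    ultimately show ?thesis unfolding P by (auto intro: gap_before_next)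
  qed
  then show ?case unfolding P_def .
qed simp

section \<open>Average costs\<close>

lemma sum_blocks_of_3:
  fixes g :: "nat \<Rightarrow> nat"
  shows "(\<Sum>t<3 * m. g t) = (\<Sum>q<m. g (3 * q) + g (3 * q + 1) + g (3 * q + 2))"
  by (induction m) (simp_all add: numeral_3_eq_3)

lemma query_blocks_of_3:
  "query (Suc D) k (3 * q) = query D k q"
  "query (Suc D) k (3 * q + 1) = k + num_keys D + 2"
  "query (Suc D) k (3 * q + 2) = query D (k + num_keys D + 3) q"
proof -
  have "(3 * q + 1) mod 3 = 1" "(3 * q + 2) mod 3 = 2" "(3 * q + 2) div 3 = q" by presburger+
  then show "query (Suc D) k (3 * q) = query D k q"
    "query (Suc D) k (3 * q + 1) = k + num_keys D + 2"
    "query (Suc D) k (3 * q + 2) = query D (k + num_keys D + 3) q"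
    by simp_all
qed

lemma length_path_gf_tree:
  "length (rpath (gf_tree (Suc D) k) (query (Suc D) k (3 * q))) =
     2 + length (rpath (gf_tree D k) (query D k q))"
  "length (rpath (gf_tree (Suc D) k) (query (Suc D) k (3 * q + 1))) = 3"
  "length (rpath (gf_tree (Suc D) k) (query (Suc D) k (3 * q + 2))) =
     1 + length (rpath (gf_tree D (k + num_keys D + 3)) (query D (k + num_keys D + 3) q))"
  unfolding query_blocks_of_3
  using query_le[of D k q] query_gt[of "k + num_keys D + 3" D q] by simp_all

text \<open>Solves \<open>g' = 2 + 2g/3\<close> from \<open>g = 1\<close>: the average is
  \<open>6 - 5 * (2/3)^D\<close>. It is multiplied by the length and written without
  subtraction.\<close>

lemma sum_path_gf_tree:
  "(\<Sum>t<3 ^ D * m. length (rpath (gf_tree D k) (query D k t))) + 5 * 2 ^ D * m = 6 * 3 ^ D * m"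
proof (induction D arbitrary: k)
  case (Suc D)
  show ?case
    using Suc[of k] Suc[of "k + num_keys D + 3"]
    unfolding power_Suc mult.assoc sum_blocks_of_3 length_path_gf_tree
    unfolding sum.distrib sum_constant card_lessThan of_nat_id by linarith
qed simp

lemma length_path_good_tree:
  "length (rpath (good_tree (Suc D) k L R) (query (Suc D) k (3 * q))) =
     1 + length (rpath (good_tree D k L (Node Leaf (k + num_keys D + 1) Leaf)) (query D k q))"
  "length (rpath (good_tree (Suc D) k L R) (query (Suc D) k (3 * q + 1))) = 1"
  "length (rpath (good_tree (Suc D) k L R) (query (Suc D) k (3 * q + 2))) =
     1 + length (rpath (good_tree D (k + num_keys D + 3) (Node Leaf (k + num_keys D + 3) Leaf) R)
           (query D (k + num_keys D + 3) q))"
  unfolding query_blocks_of_3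
  using query_le[of D k q] query_gt[of "k + num_keys D + 3" D q] by simp_all

text \<open>The average \<open>3 - 2 * (2/3)^D\<close> solves \<open>h' = 1 + 2h/3\<close> from
  \<open>h = 1\<close>. It does not depend on \<open>L\<close> and \<open>R\<close>, which no search
  enters.\<close>

lemma sum_path_good_tree:
  "(\<Sum>t<3 ^ D * m. length (rpath (good_tree D k L R) (query D k t))) + 2 * 2 ^ D * m = 3 * 3 ^ D * m"
proof (induction D arbitrary: k L R)
  case (Suc D)
  show ?case
    using Suc[of k L "Node Leaf (k + num_keys D + 1) Leaf"]
      Suc[of "k + num_keys D + 3" "Node Leaf (k + num_keys D + 3) Leaf" R]
    unfolding power_Suc mult.assoc sum_blocks_of_3 length_path_good_tree
    unfolding sum.distrib sum_constant card_lessThan of_nat_id by linarith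
qed simp

lemma gf_cost_query:
  "gf_cost (map (query D 0) [0..<3 ^ D * m]) (gf_tree D 0) + 5 * 2 ^ D * m = 6 * 3 ^ D * m"
proof -
  have "gf_step (map (query D 0) [0..<3 ^ D * m]) t (gf_tree D 0) = gf_tree D 0"
    if "t < 3 ^ D * m" for t
    by (rule gf_step_static[OF bst_gf_tree, where f = "query D 0"])
      (use that sorted_path_gf_tree in auto)
  then show ?thesis
    using sum_path_gf_tree[of D 0 m]
      gf_cost_static[OF bst_gf_tree, of "map (query D 0) [0..<3 ^ D * m]" D 0] by simp
qed

lemma opt_cost_query:
  "opt_cost (map (query D 0) [0..<3 ^ D * m]) (gf_tree D 0) + 2 * 2 ^ D * m
     \<le> num_keys D + 3 * 3 ^ D * m"
proof -
  have "bst (good_tree D 0 Leaf Leaf)" by (rule bst_good_tree) auto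
  from opt_cost_le_static[OF bst_gf_tree this, of D 0 "map (query D 0) [0..<3 ^ D * m]"]
  show ?thesis
    using sum_path_good_tree[where k = 0 and L = Leaf and R = Leaf, of D m]
    by (simp add: set_gf_tree set_good_tree)
qed

theorem theorem1:
  fixes c :: real and d :: "nat \<Rightarrow> nat \<Rightarrow> real"
  assumes "\<forall>n. (\<lambda>m. d n m / real m) \<longlonglongrightarrow> 0"
    and "\<forall>n (T0 :: nat tree) (X :: nat list).
           bst T0 \<and> set_tree T0 = {1..n} \<and> set X \<subseteq> {1..n} \<longrightarrow>
           real (gf_cost X T0) \<le> c * real (opt_cost X T0) + d n (length X)"
  shows "c \<ge> 2"
proof -
  \<comment> \<open>A nonnegative factor is needed to multiply the upper bound on
    \<open>opt_cost\<close>; the sign of \<open>c\<close> is not known yet.\<close>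
  define e where "e = max c 0"
  have divide: "a \<le> e * (n / M) + e * b + x / M" if "a * M \<le> e * (n + b * M) + x" "M > 0"
    for a b n x M :: real
    using that by (simp add: field_simps)
  \<comment> \<open>First limit: the level, and with it the number of keys, stays fixed while the
    length grows. \<open>Suc m\<close> keeps the length positive.\<close>
  have bound: "6 - 5 * (2 / 3) ^ D \<le> e * (3 - 2 * (2 / 3) ^ D)" for D
  proof -
    let ?n = "num_keys D" and ?M = "\<lambda>m. 3 ^ D * Suc m" and ?r = "(2 / 3) ^ D :: real"
    have le: "6 - 5 * ?r \<le> e * (real ?n / real (?M m)) + e * (3 - 2 * ?r) + d ?n (?M m) / real (?M m)"
      for m
    proof -
      let ?X = "map (query D 0) [0..<?M m]" and ?T = "gf_tree D 0"
      \<comment> \<open>Turns the integer terms \<open>2 ^ D * Suc m\<close> into multiples of the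
        length.\<close>
      have r: "?r * real (?M m) = 2 ^ D * real (Suc m)"
        by (simp add: power_divide field_simps)
      have "set ?X \<subseteq> {1..?n}" using query_gt[of 0 D] query_le[of D 0] by (auto simp: Suc_le_eq)
      then have "real (gf_cost ?X ?T) \<le> c * real (opt_cost ?X ?T) + d ?n (?M m)"
        using assms(2)[rule_format, of ?T ?n ?X] bst_gf_tree set_gf_tree[of D 0] by simp
      also have "c * real (opt_cost ?X ?T) \<le> e * real (opt_cost ?X ?T)"
        by (intro mult_right_mono) (auto simp: e_def)
      also have "real (opt_cost ?X ?T) \<le> real ?n + (3 - 2 * ?r) * real (?M m)"
      proof -
        have "real (opt_cost ?X ?T + 2 * 2 ^ D * Suc m) \<le> real (?n + 3 * 3 ^ D * Suc m)"
          using opt_cost_query[of D "Suc m"] by (simp only: of_nat_le_iff)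
        then show ?thesis using r by (simp add: algebra_simps)
      qed
      then have "e * real (opt_cost ?X ?T) \<le> e * (real ?n + (3 - 2 * ?r) * real (?M m))"
        by (intro mult_left_mono) (auto simp: e_def)
      finally have "real (gf_cost ?X ?T) \<le> e * (real ?n + (3 - 2 * ?r) * real (?M m)) + d ?n (?M m)"
        by linarith
      moreover have "real (gf_cost ?X ?T) = (6 - 5 * ?r) * real (?M m)"
      proof -
        have "real (gf_cost ?X ?T + 5 * 2 ^ D * Suc m) = real (6 * 3 ^ D * Suc m)"
          using gf_cost_query[of D "Suc m"] by (simp only: of_nat_eq_iff)
        then show ?thesis using r by (simp add: algebra_simps)
      qed
      moreover have "real (?M m) > 0" unfolding of_nat_0_less_iff by simp
      ultimately show ?thesis by (intro divide) (simp_all only:)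
    qed
    have M: "filterlim ?M at_top sequentially"
      by (rule filterlim_subseq) (simp add: strict_mono_def)
    have "(\<lambda>m. e * (real ?n / real (?M m)) + e * (3 - 2 * ?r) + d ?n (?M m) / real (?M m))
        \<longlonglongrightarrow> e * 0 + e * (3 - 2 * ?r) + 0"
    proof (intro tendsto_intros)
      show "(\<lambda>m. real ?n / real (?M m)) \<longlonglongrightarrow> 0"
        using filterlim_compose[OF lim_const_over_n M] .
      show "(\<lambda>m. d ?n (?M m) / real (?M m)) \<longlonglongrightarrow> 0"
        using filterlim_compose[OF assms(1)[rule_format] M] .
    qed
    then show ?thesis using le by (intro LIMSEQ_le_const) auto
  qed
  \<comment> \<open>Second limit: the level grows, and the averages tend to 6 and 3.\<close>
  have "(\<lambda>D. 6 - 5 * (2 / 3) ^ D :: real) \<longlonglongrightarrow> 6 - 5 * 0"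
    by (intro tendsto_intros LIMSEQ_realpow_zero) auto
  moreover have "(\<lambda>D. e * (3 - 2 * (2 / 3) ^ D)) \<longlonglongrightarrow> e * (3 - 2 * 0)"
    by (intro tendsto_intros LIMSEQ_realpow_zero) auto
  ultimately have "6 \<le> e * 3" using LIMSEQ_le bound by fastforce
  \<comment> \<open>Since \<open>6 \<le> e * 3\<close> rules out \<open>e = 0\<close>,
    \<open>e\<close> must be \<open>c\<close>.\<close>
  then show ?thesis by (auto simp: e_def max_def split: if_splits)
qed

end
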